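(* Let $f=\frac1n\sum_{i=1}^nf_i$ on $\mathbb{R}^d$ be $\mu$-strongly convex ($\mu>0$) with minimizer $w_*$, where each $f_i$ is convex and glocally $(L_{\max},L_{\max,*},\delta)$-smooth in iterates, and suppose $f$ satisfies interpolation. Let $w_0\in\mathbb{R}^d$, let $\epsilon$ satisfy $\|w_0-w_*\|^2>\delta>\epsilon>0$, and let $\zeta\in(0,1)$. Let $w_{t+1}=w_t-\eta_t\nabla f_{i_t}(w_t)$ for $t\ge0$, where the $i_t$ are sampled independently and uniformly from $\{1,\dots,n\}$ and $\eta_t$ is obtained by starting from some fixed $\eta_{\max}\ge1/L_{\max,*}$ and dividing the step size in half until $$f_{i_t}(w_t-\eta\nabla f_{i_t}(w_t))\le f_{i_t}(w_t)-\frac{\eta}{2}\|\nabla f_{i_t}(w_t)\|^2.$$ Let $t_\delta=\left\lceil\frac{2L_{\max}}{\mu}\log\left(\frac{\|w_0-w_*\|^2}{\delta\zeta}\right)\right\rceil$ and let $X_\delta$ be the event $\|w_{t_\delta}-w_*\|^2\le\delta$. Then $X_\delta$ has probability at least $1-\zeta$, and conditionally on it $$E\left[\|w_T-w_*\|^2\mid X_\delta\right]\le\epsilon$$ for all integers $T$ with $$T\ge2\left(\frac{L_{\max}}{\mu}\log\left(\frac{\|w_0-w_*\|^2}{\delta\zeta}\right)+\frac{L_{\max,*}}{\mu}\log\left(\frac{\delta}{\epsilon}\right)\right)+1.$$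
   Context: $\|\cdot\|$ is the Euclidean norm, functions are differentiable, and $L_{\max},L_{\max,*},\delta>0$. Expectation is over the random indices. Interpolation: $\nabla f(w)=0$ implies $\nabla f_i(w)=0$ for every $i\in\{1,\dots,n\}$. Glocal smoothness in iterates: a function $g$ is glocally $(L,L_*,\delta)$-smooth in iterates if (i) $\|\nabla g(u)-\nabla g(v)\|\le L\|u-v\|$ for all $u,v\in\mathbb{R}^d$, and (ii) $\|\nabla g(u)-\nabla g(v)\|\le L_*\|u-v\|$ for all $u,v$ in the set $\{w:\|w-w_p\|^2\le\delta\}$, where $w_p$ is the projection of $w$ onto the set of minimizers of $g$. Strong convexity: $f$ is $\mu$-strongly convex if $f(v)\ge f(u)+\langle\nabla f(u),v-u\rangle+\frac{\mu}{2}\|v-u\|^2$ for all $u,v\in\mathbb{R}^d$. The step-size search restarts from $\eta_{\max}$ at every iteration.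
   Formalization: The formal theorem adds the assumption L_{max,*} ≤ L_max; without it the claim fails, e.g. f(w)=w²/2 on ℝ, μ=L_max=1, L_{max,*}=1000, η_max=1/1000, w_0=2, δ=1, ζ=1/2, where X_δ has probability 0. *)

theory Defs
  imports "HOL-Probability.Probability"
begin

definition gradient :: "('a::real_inner \<Rightarrow> real) \<Rightarrow> 'a \<Rightarrow> 'a" where
  "gradient g x = (THE D. GDERIV g x :> D)"

definition minimizers :: "('a \<Rightarrow> real) \<Rightarrow> 'a set" where
  "minimizers g = {w. \<forall>v. g w \<le> g v}"

(* The projection w_p is closest_point (minimizers g) w. It is meaningful when g has a
   minimizer and the set of minimizers is closed and convex, as for convex differentiable
   g attaining its minimum. The definition does not force Ls \<le> L: a local constant larger
   than the global one satisfies it too. *)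
definition glocally_smooth ::
    "('a::euclidean_space \<Rightarrow> real) \<Rightarrow> real \<Rightarrow> real \<Rightarrow> real \<Rightarrow> bool" where
  "glocally_smooth g L Ls \<delta> \<longleftrightarrow>
     (\<forall>u v. norm (gradient g u - gradient g v) \<le> L * norm (u - v)) \<and>
     (let S = {w. (norm (w - closest_point (minimizers g) w))\<^sup>2 \<le> \<delta>} in
       \<forall>u\<in>S. \<forall>v\<in>S. norm (gradient g u - gradient g v) \<le> Ls * norm (u - v))"

definition strongly_convex :: "real \<Rightarrow> ('a::real_inner \<Rightarrow> real) \<Rightarrow> bool" where
  "strongly_convex \<mu> f \<longleftrightarrow>
     (\<forall>u v. f v \<ge> f u + gradient f u \<bullet> (v - u) + \<mu> / 2 * (norm (v - u))\<^sup>2)"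

definition interpolates :: "nat \<Rightarrow> (nat \<Rightarrow> 'a::real_inner \<Rightarrow> real) \<Rightarrow> ('a \<Rightarrow> real) \<Rightarrow> bool" where
  "interpolates n F f \<longleftrightarrow>
     (\<forall>w. gradient f w = 0 \<longrightarrow> (\<forall>i\<in>{1..n}. gradient (F i) w = 0))"

definition sufficient_decrease :: "('a::real_inner \<Rightarrow> real) \<Rightarrow> 'a \<Rightarrow> real \<Rightarrow> bool" where
  "sufficient_decrease g w \<eta> \<longleftrightarrow>
     g (w - \<eta> *\<^sub>R gradient g w) \<le> g w - \<eta> / 2 * (norm (gradient g w))\<^sup>2"

(* The least number of halvings exists whenever the gradient of g is globally Lipschitz,
   so the search always terminates for the functions considered here. *)
definition backtracked_step :: "real \<Rightarrow> ('a::real_inner \<Rightarrow> real) \<Rightarrow> 'a \<Rightarrow> real" where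
  "backtracked_step \<eta>max g w =
     \<eta>max / 2 ^ (LEAST k::nat. sufficient_decrease g w (\<eta>max / 2 ^ k))"

end

theory Submission
  imports Defs
begin

text \<open>
  The gradient of \<open>f\<close> vanishes at its minimizer \<open>ws\<close>, so interpolation and convexity make \<open>ws\<close> a
  minimizer of every \<open>F i\<close>, and a single step along any \<open>F i\<close> can be compared with \<open>ws\<close>.
  Expanding the square of the distance after the step and bounding the term of
  second order by the sufficient decrease condition gives
  \<open>|w' - ws|^2 \<le> |w - ws|^2 - 2 \<eta> D\<close>, where \<open>D\<close> is the gap in the tangent inequality of \<open>F i\<close>
  between \<open>w\<close> and \<open>ws\<close>. By convexity \<open>D \<ge> 0\<close>, so the distance to \<open>ws\<close> never increases, whatever
  index is drawn; averaged over the indices, \<open>D\<close> is at least \<open>\<mu> / 2 |w - ws|^2\<close>. If the accepted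
  step sizes are at least \<open>1 / (2 L)\<close>, one step thus contracts the expected squared distance by the
  factor \<open>1 - \<mu> / (2 L) \<le> exp (- \<mu> / (2 L))\<close>.

  The lower bound on the step size holds with the Lipschitz constant of the gradients on any ball
  around \<open>ws\<close> that contains \<open>w\<close>. The delicate point is that the trial point \<open>w - \<eta> \<nabla>F i(w)\<close> has to
  lie in that ball before the local constant applies to it; this is the content of
  \<open>sufficient_decrease_near_minimizer\<close>.

  These facts are used twice. On the ball of radius \<open>|w0 - ws|\<close> with the constant \<open>Lmax\<close>, the
  expected squared distance is at most \<open>\<delta> \<zeta>\<close> after \<open>t\<delta>\<close> steps, and Markov's inequality bounds the
  probability of missing \<open>X\<delta>\<close> by \<open>\<zeta>\<close>. On the event \<open>X\<delta>\<close> all later iterates remain in the ball of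
  radius \<open>sqrt \<delta>\<close>, where the constant \<open>Lmaxs\<close> governs the rate. Since \<open>X\<delta>\<close> is determined by the
  indices drawn before time \<open>t\<delta>\<close>, conditioning on it leaves the later indices uniform
  (\<open>expected_contraction\<close>), and the remaining steps shrink \<open>\<delta>\<close> to \<open>\<epsilon>\<close>.
\<close>

section \<open>Gradients, convexity and descent\<close>

text \<open>
  The derivative is a linear functional; in a Euclidean space its values on the basis are the
  coordinates of a vector representing it. This lets the definite description in \<open>gradient\<close> be
  evaluated.
\<close>
lemma GDERIV_gradient:
  fixes g :: "'a::euclidean_space \<Rightarrow> real"
  assumes "g differentiable (at x)"
  shows "GDERIV g x :> gradient g x"
proof -
  obtain D where D: "(g has_derivative D) (at x)"
    using assms by (auto simp: differentiable_def)
  define d where "d = (\<Sum>b\<in>Basis. D b *\<^sub>R b)"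
  have "D h = h \<bullet> d" for h
  proof -
    have "D h = D (\<Sum>b\<in>Basis. (h \<bullet> b) *\<^sub>R b)"
      by (simp add: euclidean_representation)
    also have "\<dots> = (\<Sum>b\<in>Basis. (h \<bullet> b) * D b)"
      using has_derivative_linear[OF D] by (simp add: linear_sum linear_cmul)
    also have "\<dots> = h \<bullet> d"
      by (simp add: d_def inner_sum_right mult.commute)
    finally show ?thesis .
  qed
  then have "GDERIV g x :> d"
    using D unfolding gderiv_def by (metis has_derivative_subst ext)
  moreover have "e = d" if "GDERIV g x :> e" for e
  proof -
    have "(\<lambda>h. h \<bullet> e) = (\<lambda>h. h \<bullet> d)"
      using that \<open>GDERIV g x :> d\<close> unfolding gderiv_def by (rule has_derivative_unique)
    then show ?thesis by (metis vector_eq_ldot)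
  qed
  ultimately show ?thesis
    unfolding gradient_def by (rule theI)
qed

lemma gradient_unique:
  fixes g :: "'a::euclidean_space \<Rightarrow> real"
  assumes "GDERIV g x :> d"
  shows "gradient g x = d"
proof -
  have "g differentiable (at x)"
    using assms unfolding gderiv_def differentiable_def by blast
  then have "(\<lambda>h. h \<bullet> gradient g x) = (\<lambda>h. h \<bullet> d)"
    using GDERIV_gradient assms unfolding gderiv_def by (intro has_derivative_unique) auto
  then show ?thesis by (metis vector_eq_ldot)
qed

lemma DERIV_along_line:
  fixes g :: "'a::euclidean_space \<Rightarrow> real"
  assumes "\<And>z. g differentiable (at z)"
  shows "((\<lambda>t. g (x + t *\<^sub>R d)) has_real_derivative gradient g (x + t *\<^sub>R d) \<bullet> d) (at t)"
proof -
  have "((\<lambda>t. x + t *\<^sub>R d) has_derivative (\<lambda>h. h *\<^sub>R d)) (at t)"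
    by (auto intro!: derivative_eq_intros)
  then have "((\<lambda>t. g (x + t *\<^sub>R d)) has_derivative
      (\<lambda>h. (h *\<^sub>R d) \<bullet> gradient g (x + t *\<^sub>R d))) (at t)"
    using has_derivative_compose GDERIV_gradient[OF assms] unfolding gderiv_def by blast
  then show ?thesis
    by (simp add: has_field_derivative_def inner_commute mult_commute_abs)
qed

text \<open>
  The restriction of \<open>g\<close> to the line through \<open>x\<close> and \<open>y\<close> is a convex function of one real
  variable, for which the tangent inequality is known.
\<close>
lemma convex_above_tangent:
  fixes g :: "'a::euclidean_space \<Rightarrow> real"
  assumes cvx: "convex_on UNIV g" and diff: "\<And>z. g differentiable (at z)"
  shows "g y \<ge> g x + gradient g x \<bullet> (y - x)"
proof -
  have "convex_on UNIV (\<lambda>t. g (x + t *\<^sub>R (y - x)))"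
  proof (rule convex_onI)
    fix t a b :: real assume "0 < t" "t < 1"
    moreover have "x + ((1 - t) *\<^sub>R a + t *\<^sub>R b) *\<^sub>R (y - x)
        = (1 - t) *\<^sub>R (x + a *\<^sub>R (y - x)) + t *\<^sub>R (x + b *\<^sub>R (y - x))"
      by (simp add: algebra_simps)
    ultimately show "g (x + ((1 - t) *\<^sub>R a + t *\<^sub>R b) *\<^sub>R (y - x))
        \<le> (1 - t) * g (x + a *\<^sub>R (y - x)) + t * g (x + b *\<^sub>R (y - x))"
      using convex_onD[OF cvx] by auto
  qed simp
  then show ?thesis
    using convex_on_imp_above_tangent[of UNIV "\<lambda>t. g (x + t *\<^sub>R (y - x))" 0 1
        "gradient g x \<bullet> (y - x)"]
      DERIV_along_line[OF diff, of x "y - x" 0] by simp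
qed

lemma gradient_at_minimizer:
  fixes g :: "'a::euclidean_space \<Rightarrow> real"
  assumes "g differentiable (at x)" "x \<in> minimizers g"
  shows "gradient g x = 0"
proof -
  have "(\<lambda>h. h \<bullet> gradient g x) = (\<lambda>h. 0)"
    using GDERIV_gradient[OF assms(1)] assms(2) unfolding gderiv_def minimizers_def
    by (intro differential_zero_maxmin[of x UNIV g]) auto
  then show ?thesis by (metis inner_eq_zero_iff)
qed

lemma convex_critical_imp_minimizer:
  fixes g :: "'a::euclidean_space \<Rightarrow> real"
  assumes "convex_on UNIV g" "\<And>z. g differentiable (at z)" "gradient g x = 0"
  shows "x \<in> minimizers g"
  using convex_above_tangent[OF assms(1,2), of x] assms(3) by (simp add: minimizers_def)

text \<open>
  The Lipschitz condition is required on a convex set only, because just the segment from \<open>x\<close> to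
  \<open>y\<close> matters: the difference of the two sides along it has a derivative of constant sign.
\<close>
lemma descent_inequality:
  fixes g :: "'a::euclidean_space \<Rightarrow> real"
  assumes diff: "\<And>z. g differentiable (at z)"
    and S: "convex S" "x \<in> S" "y \<in> S"
    and lip: "\<And>u v. u \<in> S \<Longrightarrow> v \<in> S \<Longrightarrow> norm (gradient g u - gradient g v) \<le> L * norm (u - v)"
  shows "g y \<le> g x + gradient g x \<bullet> (y - x) + L / 2 * (norm (y - x))\<^sup>2"
proof -
  define d where "d = y - x"
  define \<psi> where "\<psi> t = g (x + t *\<^sub>R d) - (t * (gradient g x \<bullet> d) + L / 2 * (norm d)\<^sup>2 * t\<^sup>2)" for t
  have "\<psi> 1 \<le> \<psi> 0"
  proof (rule DERIV_nonpos_imp_nonincreasing[where f = \<psi>])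
    fix t :: real assume t: "0 \<le> t" "t \<le> 1"
    let ?z = "x + t *\<^sub>R d"
    have "?z = (1 - t) *\<^sub>R x + t *\<^sub>R y" by (simp add: d_def algebra_simps)
    then have "?z \<in> S" using S t by (simp add: convexD)
    then have "norm (gradient g ?z - gradient g x) \<le> L * (t * norm d)"
      using lip[of ?z x] S t by simp
    then have "(gradient g ?z - gradient g x) \<bullet> d \<le> L * (t * norm d) * norm d"
      by (meson mult_right_mono norm_cauchy_schwarz norm_ge_zero order_trans)
    moreover have "(\<psi> has_real_derivative
        gradient g ?z \<bullet> d - (gradient g x \<bullet> d + L / 2 * (norm d)\<^sup>2 * (2 * t))) (at t)"
      unfolding \<psi>_def by (auto intro!: derivative_eq_intros DERIV_along_line[OF diff])
    ultimately show "\<exists>D. (\<psi> has_real_derivative D) (at t) \<and> D \<le> 0"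
      by (intro exI conjI) (auto simp: inner_diff_left power2_eq_square mult_ac)
  qed simp
  then show ?thesis by (simp add: \<psi>_def d_def)
qed

section \<open>Backtracking steps for a convex function\<close>

text \<open>
  If the segment from \<open>x\<close> to the trial point lies in the ball, the descent inequality gives the
  claim. To see that it does, let \<open>x\<close> not be a minimizer. With \<open>p\<close> the inner product of
  the gradient with \<open>x - z\<close> and \<open>a\<close> the squared norm of the gradient, the ray is no further from
  \<open>z\<close> than \<open>x\<close> is, up to the length \<open>2 p / a\<close>. If that length were below \<open>1 / L\<close>, the descent at
  its end would be strictly more than \<open>p\<close>, whereas \<open>g\<close> lies at most \<open>p\<close> above its minimum.
\<close>
lemma sufficient_decrease_near_minimizer:
  fixes g :: "'a::euclidean_space \<Rightarrow> real"
  assumes cvx: "convex_on UNIV g" and diff: "\<And>z. g differentiable (at z)"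
    and z: "z \<in> minimizers g" and x: "x \<in> cball z r" and "L > 0"
    and lip: "\<And>u v. u \<in> cball z r \<Longrightarrow> v \<in> cball z r \<Longrightarrow>
      norm (gradient g u - gradient g v) \<le> L * norm (u - v)"
    and \<eta>: "0 < \<eta>" "\<eta> \<le> 1 / L"
  shows "sufficient_decrease g x \<eta>"
proof (cases "gradient g x = 0")
  case True
  then show ?thesis by (simp add: sufficient_decrease_def)
next
  case False
  define a where "a = (norm (gradient g x))\<^sup>2"
  have "a > 0" using False by (simp add: a_def)
  define p where "p = gradient g x \<bullet> (x - z)"
  have gap: "g x - g z \<le> p"
    using convex_above_tangent[OF cvx diff, of x z] by (simp add: p_def inner_diff_right)
  have min: "g z \<le> g v" for v using z by (simp add: minimizers_def)
  have inball: "x - s *\<^sub>R gradient g x \<in> cball z r" if "0 \<le> s" "s * a \<le> 2 * p" for s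
  proof -
    have "(norm (x - s *\<^sub>R gradient g x - z))\<^sup>2 = (norm (x - z))\<^sup>2 - s * (2 * p - s * a)"
      unfolding a_def p_def power2_norm_eq_inner
      by (simp add: inner_diff_left inner_diff_right inner_commute algebra_simps)
    also have "\<dots> \<le> (norm (x - z))\<^sup>2" using that by simp
    finally have "norm (x - s *\<^sub>R gradient g x - z) \<le> norm (x - z)"
      by (rule power2_le_imp_le) simp
    then show ?thesis using x by (simp add: dist_norm norm_minus_commute)
  qed
  have descent: "g (x - s *\<^sub>R gradient g x) \<le> g x - s * a + L / 2 * (s\<^sup>2 * a)"
    if "0 \<le> s" "s * a \<le> 2 * p" for s
    using descent_inequality[OF diff convex_cball x inball[OF that] lip]
    by (simp add: a_def power2_norm_eq_inner[symmetric] power_mult_distrib)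
  have "p \<ge> 0" using gap min[of x] by simp
  have "1 / L * a \<le> 2 * p"
  proof (rule ccontr)
    assume far: "\<not> 1 / L * a \<le> 2 * p"
    define s where "s = 2 * p / a"
    have s: "s \<ge> 0" "s * a = 2 * p" using \<open>a > 0\<close> \<open>p \<ge> 0\<close> by (auto simp: s_def)
    have "L * s < 1"
      using far \<open>a > 0\<close> \<open>L > 0\<close> by (simp add: s_def field_simps)
    have "s * a - L / 2 * (s\<^sup>2 * a) \<le> p"
      using descent[of s] s gap min[of "x - s *\<^sub>R gradient g x"] by simp
    then have "2 * p - (L * s) * p \<le> p"
      using s by (simp add: power2_eq_square mult.assoc)
    then have "(1 - L * s) * p \<le> 0" by (simp add: algebra_simps)
    \<comment> \<open>With \<open>p = 0\<close> the point \<open>x\<close> would be a minimizer, where the gradient vanishes.\<close>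
    then have "p = 0" using \<open>L * s < 1\<close> \<open>p \<ge> 0\<close> by (simp add: mult_le_0_iff)
    then have "x \<in> minimizers g"
      using gap min unfolding minimizers_def by (auto intro: order_trans[of _ "g z"])
    then show False using gradient_at_minimizer[OF diff] False by blast
  qed
  then have "\<eta> * a \<le> 2 * p"
    using \<eta> \<open>a > 0\<close> by (meson mult_right_mono less_imp_le order_trans)
  from descent[OF _ this] have "g (x - \<eta> *\<^sub>R gradient g x) \<le> g x - \<eta> * a + L / 2 * (\<eta>\<^sup>2 * a)"
    using \<eta> by simp
  also have "L / 2 * (\<eta>\<^sup>2 * a) \<le> \<eta> / 2 * a"
  proof -
    have "(L * \<eta>) * (\<eta> * a) \<le> 1 * (\<eta> * a)"
      using \<eta> \<open>L > 0\<close> \<open>a > 0\<close> by (intro mult_right_mono) (auto simp: field_simps)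
    then show ?thesis by (simp add: power2_eq_square field_simps)
  qed
  finally show ?thesis by (simp add: sufficient_decrease_def a_def)
qed

lemma backtracked_step_accepted_and_large:
  assumes "L > 0" and \<eta>max: "\<eta>max \<ge> 1 / L"
    and ok: "\<And>\<eta>. 0 < \<eta> \<Longrightarrow> \<eta> \<le> 1 / L \<Longrightarrow> sufficient_decrease g x \<eta>"
  shows "sufficient_decrease g x (backtracked_step \<eta>max g x)"
    and "backtracked_step \<eta>max g x \<ge> 1 / (2 * L)"
proof -
  let ?P = "\<lambda>k::nat. sufficient_decrease g x (\<eta>max / 2 ^ k)"
  have pos: "\<eta>max > 0" using assms by (smt (verit) divide_pos_pos)
  \<comment> \<open>The first halving that is at most \<open>1 / L\<close> is accepted and still exceeds half of it.\<close>
  define k where "k = (LEAST k::nat. \<eta>max / 2 ^ k \<le> 1 / L)"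
  have "\<exists>k::nat. \<eta>max / 2 ^ k \<le> 1 / L"
  proof -
    obtain k :: nat where "\<eta>max * L < 2 ^ k" using real_arch_pow[of 2] by auto
    then show ?thesis using \<open>L > 0\<close> by (intro exI[of _ k]) (simp add: field_simps)
  qed
  then have k: "\<eta>max / 2 ^ k \<le> 1 / L" unfolding k_def by (rule LeastI_ex)
  have low: "\<eta>max / 2 ^ k \<ge> 1 / (2 * L)"
  proof (cases k)
    case 0
    have "1 / (2 * L) \<le> 1 / L" using \<open>L > 0\<close> by (simp add: field_simps)
    then show ?thesis using 0 \<eta>max by simp
  next
    case (Suc j)
    then have "\<not> \<eta>max / 2 ^ j \<le> 1 / L"
      unfolding k_def by (metis not_less_Least lessI)
    then show ?thesis using Suc \<open>L > 0\<close> by (simp add: field_simps)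
  qed
  have "?P k" using k pos by (intro ok) auto
  then show "sufficient_decrease g x (backtracked_step \<eta>max g x)"
    unfolding backtracked_step_def by (rule LeastI)
  have "(LEAST k. ?P k) \<le> k" using \<open>?P k\<close> by (rule Least_le)
  then have "\<eta>max / 2 ^ k \<le> backtracked_step \<eta>max g x"
    unfolding backtracked_step_def using pos
    by (intro divide_left_mono) (auto intro: power_increasing)
  then show "backtracked_step \<eta>max g x \<ge> 1 / (2 * L)" using low by simp
qed

definition backtracking_gradient_step :: "real \<Rightarrow> ('a::real_inner \<Rightarrow> real) \<Rightarrow> 'a \<Rightarrow> 'a" where
  "backtracking_gradient_step \<eta>max g x = x - backtracked_step \<eta>max g x *\<^sub>R gradient g x"

text \<open>
  The subtracted bracket is the gap in the tangent inequality at \<open>x\<close>. Sufficient decrease bounds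
  the second order term \<open>\<eta>^2 |\<nabla>g(x)|^2\<close> by \<open>2 \<eta> (g x - g z)\<close>, because no value of \<open>g\<close> is below
  \<open>g z\<close>; the factor \<open>2 \<eta>\<close> of the gap is then at least \<open>1 / L\<close>.
\<close>
lemma backtracking_gradient_step_distance:
  fixes g :: "'a::euclidean_space \<Rightarrow> real"
  assumes cvx: "convex_on UNIV g" and diff: "\<And>z. g differentiable (at z)"
    and z: "z \<in> minimizers g" and x: "x \<in> cball z r" and L: "L > 0" "\<eta>max \<ge> 1 / L"
    and lip: "\<And>u v. u \<in> cball z r \<Longrightarrow> v \<in> cball z r \<Longrightarrow>
      norm (gradient g u - gradient g v) \<le> L * norm (u - v)"
  shows "(norm (backtracking_gradient_step \<eta>max g x - z))\<^sup>2
    \<le> (norm (x - z))\<^sup>2 - 1 / L * (gradient g x \<bullet> (x - z) - (g x - g z))"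
proof -
  define \<eta> where "\<eta> = backtracked_step \<eta>max g x"
  note step = backtracked_step_accepted_and_large[OF L sufficient_decrease_near_minimizer[OF cvx diff z x L(1) lip],
      folded \<eta>_def, simplified]
  have "2 * \<eta> \<ge> 1 / L" "\<eta> > 0"
    using step(2) L(1) by (auto simp: field_simps intro: less_le_trans[of 0 "1 / (2 * L)"])
  let ?D = "gradient g x \<bullet> (x - z) - (g x - g z)"
  have D: "?D \<ge> 0"
    using convex_above_tangent[OF cvx diff, of x z] by (simp add: inner_diff_right)
  have "\<eta> / 2 * (norm (gradient g x))\<^sup>2 \<le> g x - g z"
    using step(1) z unfolding sufficient_decrease_def minimizers_def
    by (smt (verit) mem_Collect_eq)
  then have "(2 * \<eta>) * (\<eta> / 2 * (norm (gradient g x))\<^sup>2) \<le> (2 * \<eta>) * (g x - g z)"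
    using \<open>\<eta> > 0\<close> by (intro mult_left_mono) auto
  moreover have "(norm (backtracking_gradient_step \<eta>max g x - z))\<^sup>2
      = (norm (x - z))\<^sup>2 - 2 * \<eta> * (gradient g x \<bullet> (x - z))
        + (2 * \<eta>) * (\<eta> / 2 * (norm (gradient g x))\<^sup>2)"
    unfolding backtracking_gradient_step_def \<eta>_def[symmetric] power2_norm_eq_inner
    by (simp add: inner_diff_left inner_diff_right inner_commute algebra_simps)
  ultimately have "(norm (backtracking_gradient_step \<eta>max g x - z))\<^sup>2 \<le> (norm (x - z))\<^sup>2 - (2 * \<eta>) * ?D"
    by (simp add: algebra_simps)
  also have "\<dots> \<le> (norm (x - z))\<^sup>2 - 1 / L * ?D"
    using mult_right_mono[OF \<open>2 * \<eta> \<ge> 1 / L\<close> D] by simp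
  finally show ?thesis .
qed

lemma backtracking_gradient_step_in_cball:
  fixes g :: "'a::euclidean_space \<Rightarrow> real"
  assumes "convex_on UNIV g" "\<And>z. g differentiable (at z)" "z \<in> minimizers g"
    and "x \<in> cball z r" "L > 0" "\<eta>max \<ge> 1 / L"
    and "\<And>u v. u \<in> cball z r \<Longrightarrow> v \<in> cball z r \<Longrightarrow>
      norm (gradient g u - gradient g v) \<le> L * norm (u - v)"
  shows "backtracking_gradient_step \<eta>max g x \<in> cball z r"
proof -
  have "1 / L * (gradient g x \<bullet> (x - z) - (g x - g z)) \<ge> 0"
    using convex_above_tangent[OF assms(1,2), of x z] \<open>L > 0\<close> by (simp add: inner_diff_right)
  then have "(norm (backtracking_gradient_step \<eta>max g x - z))\<^sup>2 \<le> (norm (x - z))\<^sup>2"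
    using backtracking_gradient_step_distance[OF assms] by linarith
  then have "norm (backtracking_gradient_step \<eta>max g x - z) \<le> norm (x - z)"
    by (rule power2_le_imp_le) simp
  then show ?thesis using assms(4) by (simp add: dist_norm norm_minus_commute)
qed

lemma GDERIV_average:
  fixes F :: "nat \<Rightarrow> 'a::euclidean_space \<Rightarrow> real"
  assumes "\<And>i. i \<in> {1..n} \<Longrightarrow> F i differentiable (at x)"
  shows "GDERIV (\<lambda>v. (1 / real n) * (\<Sum>i=1..n. F i v)) x
    :> (1 / real n) *\<^sub>R (\<Sum>i=1..n. gradient (F i) x)"
proof -
  have "((\<lambda>v. (1 / real n) * (\<Sum>i=1..n. F i v)) has_derivative
      (\<lambda>h. (1 / real n) * (\<Sum>i=1..n. h \<bullet> gradient (F i) x))) (at x)"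
    using GDERIV_gradient[OF assms] unfolding gderiv_def
    by (intro has_derivative_mult_right has_derivative_sum) auto
  then show ?thesis by (simp add: gderiv_def inner_sum_right)
qed

text \<open>
  The gap in the tangent inequality is linear in the function, so the average of the gaps of the
  \<open>F i\<close> is the gap of their mean, which strong convexity bounds below. The exponential form of the
  rate is nonnegative, so that multiplying by its powers preserves inequalities.
\<close>
lemma backtracking_mean_square_contraction:
  fixes F :: "nat \<Rightarrow> 'a::euclidean_space \<Rightarrow> real"
  assumes "n \<ge> 1" and L: "L > 0" "\<eta>max \<ge> 1 / L"
    and diff: "\<And>i v. i \<in> {1..n} \<Longrightarrow> F i differentiable (at v)"
    and cvx: "\<And>i. i \<in> {1..n} \<Longrightarrow> convex_on UNIV (F i)"
    and min: "\<And>i. i \<in> {1..n} \<Longrightarrow> z \<in> minimizers (F i)"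
    and lip: "\<And>i u v. i \<in> {1..n} \<Longrightarrow> u \<in> cball z r \<Longrightarrow> v \<in> cball z r \<Longrightarrow>
      norm (gradient (F i) u - gradient (F i) v) \<le> L * norm (u - v)"
    and sc: "strongly_convex \<mu> (\<lambda>v. (1 / real n) * (\<Sum>i=1..n. F i v))"
    and x: "x \<in> cball z r"
  shows "(\<Sum>i=1..n. (norm (backtracking_gradient_step \<eta>max (F i) x - z))\<^sup>2) / n
    \<le> exp (- (\<mu> / (2 * L))) * (norm (x - z))\<^sup>2"
proof -
  define f where "f v = (1 / real n) * (\<Sum>i=1..n. F i v)" for v
  let ?D = "gradient f x \<bullet> (x - z) - (f x - f z)"
  have grad: "gradient f x = (1 / real n) *\<^sub>R (\<Sum>i=1..n. gradient (F i) x)"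
    unfolding f_def using diff by (intro gradient_unique GDERIV_average)
  have D: "?D = (1 / n) * ((\<Sum>i=1..n. gradient (F i) x) \<bullet> (x - z)
      - ((\<Sum>i=1..n. F i x) - (\<Sum>i=1..n. F i z)))"
    by (simp add: grad f_def right_diff_distrib diff_divide_distrib)
  have "(\<Sum>i=1..n. (norm (backtracking_gradient_step \<eta>max (F i) x - z))\<^sup>2)
      \<le> (\<Sum>i=1..n. (norm (x - z))\<^sup>2
          - 1 / L * (gradient (F i) x \<bullet> (x - z) - (F i x - F i z)))"
    using backtracking_gradient_step_distance[OF cvx diff min x L lip] by (intro sum_mono) blast
  also have "\<dots> = n * (norm (x - z))\<^sup>2 - 1 / L * ((\<Sum>i=1..n. gradient (F i) x) \<bullet> (x - z)
      - ((\<Sum>i=1..n. F i x) - (\<Sum>i=1..n. F i z)))"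
    by (simp only: sum_subtractf sum_distrib_left[symmetric] inner_sum_left) simp
  also have "\<dots> = n * ((norm (x - z))\<^sup>2 - 1 / L * ?D)"
    using \<open>n \<ge> 1\<close> by (simp add: D right_diff_distrib)
  finally have "(\<Sum>i=1..n. (norm (backtracking_gradient_step \<eta>max (F i) x - z))\<^sup>2) / n
      \<le> (norm (x - z))\<^sup>2 - 1 / L * ?D"
    using \<open>n \<ge> 1\<close> by (simp add: divide_le_eq mult.commute)
  also have "\<dots> \<le> (norm (x - z))\<^sup>2 - 1 / L * (\<mu> / 2 * (norm (x - z))\<^sup>2)"
  proof -
    have "f z \<ge> f x + gradient f x \<bullet> (z - x) + \<mu> / 2 * (norm (z - x))\<^sup>2"
      using sc unfolding strongly_convex_def f_def[symmetric, abs_def] by blast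
    then have "\<mu> / 2 * (norm (x - z))\<^sup>2 \<le> ?D"
      by (simp add: inner_diff_right norm_minus_commute)
    then have "1 / L * (\<mu> / 2 * (norm (x - z))\<^sup>2) \<le> 1 / L * ?D"
      using L by (intro mult_left_mono) auto
    then show ?thesis by linarith
  qed
  also have "\<dots> = (1 - \<mu> / (2 * L)) * (norm (x - z))\<^sup>2"
    using L by (simp add: field_simps)
  also have "\<dots> \<le> exp (- (\<mu> / (2 * L))) * (norm (x - z))\<^sup>2"
    using exp_ge_add_one_self[of "- (\<mu> / (2 * L))"] by (intro mult_right_mono) auto
  finally show ?thesis .
qed

text \<open>
  The projection onto the minimizers is at most as far from a point as the particular minimizer
  \<open>z\<close>, so the ball around \<open>z\<close> lies in the region where the local constant is valid.
\<close>
lemma glocally_smooth_imp_lipschitz_near_minimizer: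
  fixes g :: "'a::euclidean_space \<Rightarrow> real"
  assumes diff: "\<And>z. g differentiable (at z)" and z: "z \<in> minimizers g"
    and smooth: "glocally_smooth g L Ls \<delta>" and "\<delta> \<ge> 0"
    and uv: "u \<in> cball z (sqrt \<delta>)" "v \<in> cball z (sqrt \<delta>)"
  shows "norm (gradient g u - gradient g v) \<le> Ls * norm (u - v)"
proof -
  have cont: "continuous_on UNIV g"
    using diff by (simp add: continuous_on_eq_continuous_at differentiable_imp_continuous_within)
  have closed: "closed (minimizers g)"
    unfolding minimizers_def using cont by (intro closed_Collect_all closed_Collect_le) auto
  have "(norm (p - closest_point (minimizers g) p))\<^sup>2 \<le> \<delta>" if "p \<in> cball z (sqrt \<delta>)" for p
  proof -
    have "norm (p - closest_point (minimizers g) p) \<le> sqrt \<delta>"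
      using closest_point_le[OF closed z, of p] that by (simp add: dist_norm norm_minus_commute)
    then show ?thesis using \<open>\<delta> \<ge> 0\<close> by (simp add: real_le_rsqrt sqrt_ge_absD)
  qed
  then show ?thesis
    using smooth uv unfolding glocally_smooth_def Let_def by blast
qed

section \<open>Processes driven by uniform independent indices\<close>

locale uniform_index_process = prob_space M for M :: "'s measure" +
  fixes n :: nat and idx :: "nat \<Rightarrow> 's \<Rightarrow> nat"
  assumes indep: "indep_vars (\<lambda>_. count_space {1..n}) idx UNIV"
    and uniform: "\<And>t. distr M (count_space {1..n}) (idx t) = uniform_count_measure {1..n}"
begin

text \<open>
  Restricting to \<open>{..<t}\<close> makes the histories elements of a finite set, so that every function of a
  history is measurable and integrable.
\<close>
definition history :: "nat \<Rightarrow> 's \<Rightarrow> nat \<Rightarrow> nat" where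
  "history t s = (\<lambda>j\<in>{..<t}. idx j s)"

definition histories :: "nat \<Rightarrow> (nat \<Rightarrow> nat) set" where
  "histories t = {..<t} \<rightarrow>\<^sub>E {1..n}"

lemma idx_measurable [measurable]: "idx t \<in> measurable M (count_space {1..n})"
  using indep unfolding indep_vars_def by auto

lemma idx_range: "s \<in> space M \<Longrightarrow> idx t s \<in> {1..n}"
  using measurable_space[OF idx_measurable] by simp

lemma finite_histories: "finite (histories t)"
  unfolding histories_def by (intro finite_PiE) auto

lemma card_histories: "card (histories t) = n ^ t"
  unfolding histories_def by (simp add: card_PiE)

lemma history_in_histories: "s \<in> space M \<Longrightarrow> history t s \<in> histories t"
  using idx_range by (auto simp: history_def histories_def)

lemma restrict_history: "t \<le> u \<Longrightarrow> restrict (history u s) {..<t} = history t s"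
  by (auto simp: history_def restrict_def)

lemma history_eq_Inter:
  assumes "h \<in> histories t" "t \<noteq> 0"
  shows "{s \<in> space M. history t s = h} = (\<Inter>j\<in>{..<t}. idx j -` {h j} \<inter> space M)"
proof -
  have "history t s = h \<longleftrightarrow> (\<forall>j<t. idx j s = h j)" for s
    using assms(1) unfolding history_def histories_def
    by (metis lessThan_iff restrict_PiE_iff restrict_apply' restrict_ext PiE_restrict)
  then show ?thesis using assms(2) by auto
qed

lemma prob_history:
  assumes h: "h \<in> histories t"
  shows "{s \<in> space M. history t s = h} \<in> events"
    and "prob {s \<in> space M. history t s = h} = 1 / n ^ t"
proof -
  have h_range: "h j \<in> {1..n}" if "j < t" for j
    using PiE_mem[of h "{..<t}" "\<lambda>_. {1..n}" j] h that by (simp add: histories_def)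
  have event: "idx j -` {h j} \<inter> space M \<in> events" if "j < t" for j
    using h_range[OF that] by (intro measurable_sets[OF idx_measurable]) auto
  have "{s \<in> space M. history t s = h} \<in> events
      \<and> prob {s \<in> space M. history t s = h} = 1 / n ^ t"
  proof (cases "t = 0")
    case True
    then have "{s \<in> space M. history t s = h} = space M"
      using h by (auto simp: history_def histories_def)
    then show ?thesis using True by (simp add: prob_space)
  next
    case False
    have "prob (idx j -` {h j} \<inter> space M) = 1 / n" if "j < t" for j
    proof -
      have "prob (idx j -` {h j} \<inter> space M)
          = measure (distr M (count_space {1..n}) (idx j)) {h j}"
        using h_range[OF that] by (subst measure_distr[OF idx_measurable]) auto
      also have "\<dots> = 1 / n"
        unfolding uniform using h_range[OF that] by (subst measure_uniform_count_measure) auto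
      finally show ?thesis .
    qed
    moreover have "prob (\<Inter>j\<in>{..<t}. idx j -` {h j} \<inter> space M)
        = (\<Prod>j\<in>{..<t}. prob (idx j -` {h j} \<inter> space M))"
      using False h_range by (intro indep_varsD[OF indep]) auto
    ultimately have "prob (\<Inter>j\<in>{..<t}. idx j -` {h j} \<inter> space M) = 1 / n ^ t"
      by (simp add: power_one_over)
    moreover have "(\<Inter>j\<in>{..<t}. idx j -` {h j} \<inter> space M) \<in> events"
      using False event by (intro sets.finite_INT) auto
    ultimately show ?thesis by (simp only: history_eq_Inter[OF h False])
  qed
  then show "{s \<in> space M. history t s = h} \<in> events"
    and "prob {s \<in> space M. history t s = h} = 1 / n ^ t" by auto
qed

lemma history_vimage: "history t -` {h} \<inter> space M = {s \<in> space M. history t s = h}"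
  by auto

lemma history_measurable [measurable]: "history t \<in> measurable M (count_space (histories t))"
proof -
  have "history t -` {h} \<inter> space M \<in> events" if "h \<in> histories t" for h
    using prob_history(1)[OF that] by (simp add: history_vimage)
  then show ?thesis
    using history_in_histories by (auto simp: measurable_count_space_eq2[OF finite_histories])
qed

text \<open>
  Independence and uniformity together say that all index sequences of a given length are equally
  likely; expectations thereby become finite averages.
\<close>
lemma distr_history:
  "distr M (count_space (histories t)) (history t) = uniform_count_measure (histories t)"
proof (rule measure_eqI_finite[OF _ _ finite_histories])
  fix h assume h: "h \<in> histories t"
  have "emeasure (distr M (count_space (histories t)) (history t)) {h} = ennreal (1 / n ^ t)"
    using h prob_history(2)[OF h]
    by (simp add: emeasure_distr history_vimage emeasure_eq_measure)
  also have "\<dots> = emeasure (uniform_count_measure (histories t)) {h}"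
    using h by (simp add: emeasure_uniform_count_measure finite_histories card_histories)
  finally show "emeasure (distr M (count_space (histories t)) (history t)) {h}
    = emeasure (uniform_count_measure (histories t)) {h}" .
qed (auto simp: sets_uniform_count_measure)

lemma history_function_measurable:
  fixes \<Phi> :: "(nat \<Rightarrow> nat) \<Rightarrow> real"
  shows "(\<lambda>s. \<Phi> (history t s)) \<in> borel_measurable M"
proof -
  have "\<Phi> \<in> borel_measurable (count_space (histories t))"
    by (simp only: measurable_count_space_eq1) simp
  with history_measurable show ?thesis by (rule measurable_compose)
qed

lemma history_function_integrable:
  fixes \<Phi> :: "(nat \<Rightarrow> nat) \<Rightarrow> real"
  shows "integrable M (\<lambda>s. \<Phi> (history t s))"
proof (rule integrable_const_bound[OF _ history_function_measurable])
  show "AE s in M. norm (\<Phi> (history t s)) \<le> Max ((\<lambda>h. norm (\<Phi> h)) ` histories t)"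
    using history_in_histories finite_histories by (intro AE_I2 Max_ge) auto
qed

lemma expectation_history:
  fixes \<Phi> :: "(nat \<Rightarrow> nat) \<Rightarrow> real"
  shows "expectation (\<lambda>s. \<Phi> (history t s)) = (\<Sum>h\<in>histories t. \<Phi> h) / n ^ t"
proof -
  have "expectation (\<lambda>s. \<Phi> (history t s))
      = integral\<^sup>L (distr M (count_space (histories t)) (history t)) \<Phi>"
    by (rule integral_distr[symmetric]) auto
  then show ?thesis
    by (simp add: distr_history integral_uniform_count_measure finite_histories card_histories)
qed

text \<open>
  This is the tower rule for conditioning on the past: the next index may be averaged out while the
  history is kept. A history of length \<open>Suc t\<close> is a history of length \<open>t\<close> with one more index.
\<close>
lemma expectation_next_index:
  fixes \<Psi> :: "nat \<Rightarrow> (nat \<Rightarrow> nat) \<Rightarrow> real"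
  shows "expectation (\<lambda>s. \<Psi> (idx t s) (history t s))
    = expectation (\<lambda>s. (\<Sum>i=1..n. \<Psi> i (history t s)) / n)"
proof -
  have split: "histories (Suc t) = (\<lambda>(i, h). h(t := i)) ` ({1..n} \<times> histories t)"
    unfolding histories_def by (simp add: lessThan_Suc PiE_insert_eq)
  have inj: "inj_on (\<lambda>(i, h). h(t := i)) ({1..n} \<times> histories t)"
    unfolding histories_def by (rule inj_combinator) simp
  have restr: "restrict h {..<t} = h" if "h \<in> histories t" for h
    using that unfolding histories_def by (simp add: PiE_restrict)
  have "expectation (\<lambda>s. \<Psi> (idx t s) (history t s))
      = expectation (\<lambda>s. (\<lambda>h. \<Psi> (h t) (restrict h {..<t})) (history (Suc t) s))"
    by (simp add: restrict_history) (simp add: history_def)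
  also have "\<dots> = (\<Sum>h\<in>histories (Suc t). \<Psi> (h t) (restrict h {..<t})) / n ^ Suc t"
    by (rule expectation_history)
  also have "(\<Sum>h\<in>histories (Suc t). \<Psi> (h t) (restrict h {..<t}))
      = (\<Sum>(i, h)\<in>{1..n} \<times> histories t. \<Psi> i h)"
    unfolding split sum.reindex[OF inj] by (intro sum.cong) (auto simp: restr)
  also have "\<dots> = (\<Sum>h\<in>histories t. \<Sum>i=1..n. \<Psi> i h)"
    by (subst sum.cartesian_product[symmetric]) (rule sum.swap)
  also have "\<dots> / n ^ Suc t = (\<Sum>h\<in>histories t. (\<Sum>i=1..n. \<Psi> i h) / n) / n ^ t"
    by (simp add: sum_divide_distrib[symmetric])
  also have "\<dots> = expectation (\<lambda>s. (\<Sum>i=1..n. \<Psi> i (history t s)) / n)"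
    by (rule expectation_history[symmetric])
  finally show ?thesis .
qed

lemma iterate_of_history:
  fixes w :: "nat \<Rightarrow> 's \<Rightarrow> 'b"
  assumes "\<And>s. s \<in> space M \<Longrightarrow> w 0 s = init"
    and "\<And>t s. s \<in> space M \<Longrightarrow> w (Suc t) s = G (idx t s) (w t s)"
  shows "\<exists>W. \<forall>s\<in>space M. w t s = W (history t s)"
proof (induction t)
  case 0
  then show ?case using assms(1) by auto
next
  case (Suc t)
  then obtain W where W: "\<forall>s\<in>space M. w t s = W (history t s)" by blast
  have "w (Suc t) s = (\<lambda>h. G (h t) (W (restrict h {..<t}))) (history (Suc t) s)"
    if "s \<in> space M" for s
    using assms(2)[OF that] W that by (simp add: restrict_history) (simp add: history_def)
  then show ?case by (intro exI ballI)
qed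

text \<open>
  Two times are involved because the event on which the process is conditioned refers to an earlier
  time than the quantity that is averaged.
\<close>
lemma iterate_function_of_history:
  fixes w :: "nat \<Rightarrow> 's \<Rightarrow> 'b" and \<phi> :: "'b \<Rightarrow> 'b \<Rightarrow> real"
  assumes "\<And>s. s \<in> space M \<Longrightarrow> w 0 s = init"
    and "\<And>t s. s \<in> space M \<Longrightarrow> w (Suc t) s = G (idx t s) (w t s)"
    and "t \<le> u"
  shows "\<exists>\<Phi>. \<forall>s\<in>space M. \<phi> (w t s) (w u s) = \<Phi> (history u s)"
proof -
  obtain V W where "\<forall>s\<in>space M. w t s = V (history t s)"
    and "\<forall>s\<in>space M. w u s = W (history u s)"
    using iterate_of_history[of w init G, OF assms(1,2)] by metis
  then have "\<phi> (w t s) (w u s) = (\<lambda>h. \<phi> (V (restrict h {..<t})) (W h)) (history u s)"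
    if "s \<in> space M" for s
    using that \<open>t \<le> u\<close> by (simp add: restrict_history)
  then show ?thesis by (intro exI ballI)
qed

lemma iterate_function_integrable:
  fixes w :: "nat \<Rightarrow> 's \<Rightarrow> 'b" and \<phi> :: "'b \<Rightarrow> 'b \<Rightarrow> real"
  assumes "\<And>s. s \<in> space M \<Longrightarrow> w 0 s = init"
    and "\<And>t s. s \<in> space M \<Longrightarrow> w (Suc t) s = G (idx t s) (w t s)"
    and "t \<le> u"
  shows "integrable M (\<lambda>s. \<phi> (w t s) (w u s))"
proof -
  obtain \<Phi> where "\<forall>s\<in>space M. \<phi> (w t s) (w u s) = \<Phi> (history u s)"
    using iterate_function_of_history[of w init G t u \<phi>, OF assms] by blast
  then have "integrable M (\<lambda>s. \<phi> (w t s) (w u s)) \<longleftrightarrow> integrable M (\<lambda>s. \<Phi> (history u s))"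
    by (intro Bochner_Integration.integrable_cong) auto
  then show ?thesis using history_function_integrable by blast
qed

text \<open>
  Whether \<open>w t\<close> lies in \<open>B\<close> is decided by the first \<open>t\<close> indices, and by invariance all later iterates
  then lie in \<open>B\<close> as well. Averaging out one index at a time by \<open>expectation_next_index\<close> therefore
  gains a factor \<open>q\<close> at each step. Up to division by the probability of the starting event, both
  sides are conditional expectations given that event.
\<close>
lemma expected_contraction:
  fixes w :: "nat \<Rightarrow> 's \<Rightarrow> 'b" and V :: "'b \<Rightarrow> real"
  assumes start: "\<And>s. s \<in> space M \<Longrightarrow> w 0 s = init"
    and step: "\<And>t s. s \<in> space M \<Longrightarrow> w (Suc t) s = G (idx t s) (w t s)"
    and inv: "\<And>i x. i \<in> {1..n} \<Longrightarrow> x \<in> B \<Longrightarrow> G i x \<in> B"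
    and contr: "\<And>x. x \<in> B \<Longrightarrow> (\<Sum>i=1..n. V (G i x)) / n \<le> q * V x"
    and "q \<ge> 0"
  shows "expectation (\<lambda>s. indicator B (w t s) * V (w (t + k) s))
    \<le> q ^ k * expectation (\<lambda>s. indicator B (w t s) * V (w t s))"
proof (induction k)
  case (Suc k)
  let ?u = "t + k"
  note integrable = iterate_function_integrable[of w init G, OF start step]
  obtain W where W: "\<And>s. s \<in> space M \<Longrightarrow> w ?u s = W (history ?u s)"
    using iterate_of_history[of w init G ?u, OF start step] by blast
  obtain C :: "_ \<Rightarrow> real" where C: "\<And>s. s \<in> space M \<Longrightarrow> indicator B (w t s) = C (history ?u s)"
    using iterate_function_of_history[of w init G t ?u "\<lambda>x y. indicator B x", OF start step] by auto
  have stays: "w (t + j) s \<in> B" if "s \<in> space M" "w t s \<in> B" for s j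
    by (induction j) (simp_all add: that step inv[OF idx_range[OF that(1)]])
  have "expectation (\<lambda>s. indicator B (w t s) * V (w (t + Suc k) s))
      = expectation (\<lambda>s. C (history ?u s) * V (G (idx ?u s) (W (history ?u s))))"
    by (intro Bochner_Integration.integral_cong) (auto simp: step W C)
  also have "\<dots> = expectation (\<lambda>s. (\<Sum>i=1..n. C (history ?u s) * V (G i (W (history ?u s)))) / n)"
    by (rule expectation_next_index)
  also have "\<dots> = expectation (\<lambda>s. indicator B (w t s) * ((\<Sum>i=1..n. V (G i (w ?u s))) / n))"
    by (intro Bochner_Integration.integral_cong) (auto simp: W C sum_distrib_left)
  also have "\<dots> \<le> expectation (\<lambda>s. q * (indicator B (w t s) * V (w ?u s)))"
  proof (rule integral_mono)
    show "integrable M (\<lambda>s. indicator B (w t s) * ((\<Sum>i=1..n. V (G i (w ?u s))) / n))"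
      using integrable[of t ?u "\<lambda>x y. indicator B x * ((\<Sum>i=1..n. V (G i y)) / n)"] by simp
    show "integrable M (\<lambda>s. q * (indicator B (w t s) * V (w ?u s)))"
      using integrable[of t ?u "\<lambda>x y. q * (indicator B x * V y)"] by simp
    show "indicator B (w t s) * ((\<Sum>i=1..n. V (G i (w ?u s))) / n)
        \<le> q * (indicator B (w t s) * V (w ?u s))" if "s \<in> space M" for s
    proof (cases "w t s \<in> B")
      case True
      then show ?thesis using contr[OF stays[OF that True]] by simp
    qed simp
  qed
  also have "\<dots> = q * expectation (\<lambda>s. indicator B (w t s) * V (w ?u s))"
    by simp
  also have "\<dots> \<le> q * (q ^ k * expectation (\<lambda>s. indicator B (w t s) * V (w t s)))"
    using Suc \<open>q \<ge> 0\<close> by (rule mult_left_mono)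
  finally show ?case by (simp add: mult_ac)
qed simp

end

section \<open>Convergence with glocal smoothness\<close>

lemma (in prob_space) integral_uniform_measure:
  fixes g :: "'a \<Rightarrow> real"
  assumes X: "X \<in> events" "prob X > 0" and g: "g \<in> borel_measurable M"
  shows "(\<integral>s. g s \<partial>uniform_measure M X) = expectation (\<lambda>s. indicator X s * g s) / prob X"
proof -
  have "uniform_measure M X = density M (\<lambda>s. ennreal (indicator X s / prob X))"
    unfolding uniform_measure_def using X
    by (intro density_cong) (auto simp: emeasure_eq_measure divide_ennreal[of 1 "prob X", simplified] split: split_indicator
        intro!: AE_I2)
  also have "integral\<^sup>L \<dots> g = expectation (\<lambda>s. (indicator X s / prob X) *\<^sub>R g s)"
    using X g by (intro integral_density) auto
  finally show ?thesis by simp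
qed

lemma exp_rate_power_le:
  fixes \<mu> L a :: real
  assumes "\<mu> > 0" "L > 0" "a > 0" "real k \<ge> 2 * L / \<mu> * ln a"
  shows "exp (- (\<mu> / (2 * L))) ^ k \<le> 1 / a"
proof -
  have "ln a \<le> real k * (\<mu> / (2 * L))"
    using assms by (simp add: field_simps)
  then have "exp (- (real k * (\<mu> / (2 * L)))) \<le> exp (- ln a)" by simp
  then show ?thesis
    unfolding exp_of_nat_mult[symmetric]
    using \<open>a > 0\<close> by (simp add: exp_minus[of "ln a"] inverse_eq_divide)
qed

theorem theorem8:
  fixes F :: "nat \<Rightarrow> real ^ 'd \<Rightarrow> real"
    and f :: "real ^ 'd \<Rightarrow> real"
    and n :: nat
    and \<mu> Lmax Lmaxs \<delta> \<epsilon> \<zeta> \<eta>max :: real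
    and w0 ws :: "real ^ 'd"
    and M :: "'s measure"
    and idx :: "nat \<Rightarrow> 's \<Rightarrow> nat"
    and w :: "nat \<Rightarrow> 's \<Rightarrow> real ^ 'd"
    and \<eta> :: "nat \<Rightarrow> 's \<Rightarrow> real"
    and t\<delta> :: nat
    and X\<delta> :: "'s set"
  assumes "n \<ge> 1"
    and "Lmax > 0" and "Lmaxs > 0" and "Lmaxs \<le> Lmax"
    and "\<And>v. f v = (1 / real n) * (\<Sum>i=1..n. F i v)"
    and "\<mu> > 0" and "strongly_convex \<mu> f"
    and "ws \<in> minimizers f"
    and "\<And>i v. i \<in> {1..n} \<Longrightarrow> F i differentiable (at v)"
    and "\<And>i. i \<in> {1..n} \<Longrightarrow> convex_on UNIV (F i)"
    and "\<And>i. i \<in> {1..n} \<Longrightarrow> glocally_smooth (F i) Lmax Lmaxs \<delta>"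
    and "interpolates n F f"
    and "(norm (w0 - ws))\<^sup>2 > \<delta>" and "\<delta> > \<epsilon>" and "\<epsilon> > 0"
    and "0 < \<zeta>" and "\<zeta> < 1"
    and "\<eta>max \<ge> 1 / Lmaxs"
    and "prob_space M"
    and "prob_space.indep_vars M (\<lambda>_. count_space {1..n}) idx UNIV"
    and "\<And>t. distr M (count_space {1..n}) (idx t) = uniform_count_measure {1..n}"
    and "\<And>s. s \<in> space M \<Longrightarrow> w 0 s = w0"
    and "\<And>t s. s \<in> space M \<Longrightarrow> \<eta> t s = backtracked_step \<eta>max (F (idx t s)) (w t s)"
    and "\<And>t s. s \<in> space M \<Longrightarrow>
           w (Suc t) s = w t s - \<eta> t s *\<^sub>R gradient (F (idx t s)) (w t s)"
    and "t\<delta> = nat \<lceil>2 * Lmax / \<mu> * ln ((norm (w0 - ws))\<^sup>2 / (\<delta> * \<zeta>))\<rceil>"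
    and "X\<delta> = {s \<in> space M. (norm (w t\<delta> s - ws))\<^sup>2 \<le> \<delta>}"
  shows "measure M X\<delta> \<ge> 1 - \<zeta> \<and>
    (\<forall>T::nat. real T \<ge> 2 * (Lmax / \<mu> * ln ((norm (w0 - ws))\<^sup>2 / (\<delta> * \<zeta>))
                            + Lmaxs / \<mu> * ln (\<delta> / \<epsilon>)) + 1 \<longrightarrow>
       (\<integral>s. (norm (w T s - ws))\<^sup>2 \<partial>(uniform_measure M X\<delta>)) \<le> \<epsilon>)"
proof -
  note diff = assms(9) and cvx = assms(10) and smooth = assms(11)
  interpret prob_space M by fact
  interpret uniform_index_process M n idx
    by unfold_locales (use assms(20,21) in auto)
  have f: "f = (\<lambda>v. (1 / real n) * (\<Sum>i=1..n. F i v))" using assms(5) by auto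
  define G where "G i = backtracking_gradient_step \<eta>max (F i)" for i
  have step: "w (Suc t) s = G (idx t s) (w t s)" if "s \<in> space M" for t s
    using assms(23,24)[OF that] by (simp add: G_def backtracking_gradient_step_def)

  have "f differentiable (at ws)"
    using GDERIV_average[of n F ws] diff unfolding f gderiv_def differentiable_def by blast
  then have "gradient f ws = 0" using assms(8) by (rule gradient_at_minimizer)
  then have min: "ws \<in> minimizers (F i)" if "i \<in> {1..n}" for i
    using assms(12) that unfolding interpolates_def
    by (intro convex_critical_imp_minimizer[OF cvx diff]) auto

  define d where "d x = (norm (x - ws))\<^sup>2" for x
  \<comment> \<open>The two phases differ in the radius \<open>r\<close>, the constant \<open>L\<close> and the starting time \<open>t\<close> only.\<close>
  have decay: "expectation (\<lambda>s. indicator (cball ws r) (w t s) * d (w (t + k) s))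
      \<le> exp (- (\<mu> / (2 * L))) ^ k * expectation (\<lambda>s. indicator (cball ws r) (w t s) * d (w t s))"
    if L: "L > 0" "\<eta>max \<ge> 1 / L"
      and lip: "\<And>i u v. i \<in> {1..n} \<Longrightarrow> u \<in> cball ws r \<Longrightarrow> v \<in> cball ws r \<Longrightarrow>
        norm (gradient (F i) u - gradient (F i) v) \<le> L * norm (u - v)" for r L t k
  proof (rule expected_contraction[where init = w0 and G = G])
    show "G i x \<in> cball ws r" if "i \<in> {1..n}" "x \<in> cball ws r" for i x
      unfolding G_def using backtracking_gradient_step_in_cball[OF cvx diff min _ L lip] that by blast
    show "(\<Sum>i=1..n. d (G i x)) / n \<le> exp (- (\<mu> / (2 * L))) * d x" if "x \<in> cball ws r" for x
      unfolding G_def d_def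
      using assms(7)[unfolded f]
      by (intro backtracking_mean_square_contraction[where r = r] assms(1) L diff cvx min lip that)
  qed (use assms(22) step in auto)

  have integrable_iterates: "integrable M (\<lambda>s. \<phi> (w t s) (w u s))" if "t \<le> u"
    for t u and \<phi> :: "real ^ 'd \<Rightarrow> real ^ 'd \<Rightarrow> real"
    using assms(22) step that by (rule iterate_function_integrable)
  have integrable_d: "integrable M (\<lambda>s. d (w t s))" for t
    using integrable_iterates[of t t "\<lambda>x y. d x"] by simp
  then have d_measurable [measurable]: "(\<lambda>s. d (w t s)) \<in> borel_measurable M" for t
    by auto
  have "\<delta> > 0" using assms(14,15) by simp
  have X_def: "X\<delta> = {s \<in> space M. d (w t\<delta> s) \<le> \<delta>}" using assms(26) by (simp add: d_def)
  have X: "X\<delta> \<in> events" unfolding X_def by measurable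
  then have X_integrable: "integrable M (indicator X\<delta> :: 's \<Rightarrow> real)"
    by (intro integrable_real_indicator) (auto simp: less_top[symmetric])
  have X_cball: "indicator X\<delta> s = (indicator (cball ws (sqrt \<delta>)) (w t\<delta> s) :: real)"
    if "s \<in> space M" for s
    using that \<open>\<delta> > 0\<close> real_sqrt_le_iff[of "d (w t\<delta> s)" \<delta>]
    by (simp add: X_def d_def dist_norm norm_minus_commute indicator_def)

  let ?a = "(norm (w0 - ws))\<^sup>2 / (\<delta> * \<zeta>)"
  have d0: "d w0 > \<delta>" using assms(13) by (simp add: d_def)
  have "\<delta> * \<zeta> < \<delta>" using \<open>\<delta> > 0\<close> assms(17) by simp
  then have "\<delta> * \<zeta> < d w0" using d0 by linarith
  then have "?a > 1" using \<open>\<delta> > 0\<close> assms(16) by (simp add: d_def)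
  have "real t\<delta> \<ge> 2 * Lmax / \<mu> * ln ?a" unfolding assms(25) by (rule real_nat_ceiling_ge)
  then have rate: "exp (- (\<mu> / (2 * Lmax))) ^ t\<delta> \<le> 1 / ?a"
    using \<open>?a > 1\<close> assms(2,6) by (intro exp_rate_power_le) auto

  \<comment> \<open>First phase: the initial point lies in the ball, so the indicator is constantly one.\<close>
  have prob_X: "prob X\<delta> \<ge> 1 - \<zeta>"
  proof -
    have "1 / Lmax \<le> \<eta>max"
      using assms(2,3,4,18) by (meson frac_le order_trans zero_le_one order_refl)
    then have "expectation (\<lambda>s. indicator (cball ws (norm (w0 - ws))) (w 0 s) * d (w (0 + t\<delta>) s))
        \<le> exp (- (\<mu> / (2 * Lmax))) ^ t\<delta>
          * expectation (\<lambda>s. indicator (cball ws (norm (w0 - ws))) (w 0 s) * d (w 0 s))"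
      using smooth assms(2) unfolding glocally_smooth_def by (intro decay) auto
    also have "expectation (\<lambda>s. indicator (cball ws (norm (w0 - ws))) (w 0 s) * d (w (0 + t\<delta>) s))
        = expectation (\<lambda>s. d (w t\<delta> s))"
      using assms(22)
      by (intro Bochner_Integration.integral_cong) (auto simp: dist_norm norm_minus_commute)
    also have "expectation (\<lambda>s. indicator (cball ws (norm (w0 - ws))) (w 0 s) * d (w 0 s))
        = expectation (\<lambda>s. d w0)"
      using assms(22)
      by (intro Bochner_Integration.integral_cong) (auto simp: dist_norm norm_minus_commute)
    also have "\<dots> = d w0" by (simp add: prob_space)
    also have "exp (- (\<mu> / (2 * Lmax))) ^ t\<delta> * d w0 \<le> 1 / ?a * d w0"
      using rate by (intro mult_right_mono) (auto simp: d_def)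
    also have "\<dots> = \<delta> * \<zeta>" using d0 \<open>\<delta> > 0\<close> by (auto simp: d_def)
    finally have "expectation (\<lambda>s. d (w t\<delta> s)) \<le> \<delta> * \<zeta>" .
    \<comment> \<open>Markov's inequality: off \<open>X\<delta>\<close> the squared distance exceeds \<open>\<delta>\<close>.\<close>
    moreover have "expectation (\<lambda>s. \<delta> * (1 - indicator X\<delta> s)) \<le> expectation (\<lambda>s. d (w t\<delta> s))"
    proof (rule integral_mono[OF _ integrable_d])
      show "integrable M (\<lambda>s. \<delta> * (1 - indicator X\<delta> s))"
        using X_integrable by simp
      show "\<delta> * (1 - indicator X\<delta> s) \<le> d (w t\<delta> s)" if "s \<in> space M" for s
        using that by (auto simp: X_def d_def indicator_def)
    qed
    moreover have "expectation (\<lambda>s. \<delta> * (1 - indicator X\<delta> s)) = \<delta> * (1 - prob X\<delta>)"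
      using X X_integrable by (simp add: prob_space)
    ultimately have "\<delta> * (1 - prob X\<delta>) \<le> \<delta> * \<zeta>" by linarith
    then show ?thesis using \<open>\<delta> > 0\<close> by simp
  qed
  then have "prob X\<delta> > 0" using assms(17) by simp

  have "(\<integral>s. d (w T s) \<partial>uniform_measure M X\<delta>) \<le> \<epsilon>"
    if T: "real T \<ge> 2 * (Lmax / \<mu> * ln ?a + Lmaxs / \<mu> * ln (\<delta> / \<epsilon>)) + 1" for T
  proof -
    have "ln ?a \<ge> 0" using \<open>?a > 1\<close> by simp
    then have "2 * Lmax / \<mu> * ln ?a \<ge> 0" using assms(2,6) by simp
    \<comment> \<open>The summand \<open>1\<close> in the bound on \<open>T\<close> pays for rounding \<open>t\<delta>\<close> up.\<close>
    then have "real t\<delta> \<le> 2 * Lmax / \<mu> * ln ?a + 1" unfolding assms(25) by linarith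
    then have after: "real T - real t\<delta> \<ge> 2 * Lmaxs / \<mu> * ln (\<delta> / \<epsilon>)"
      using T by (simp add: distrib_left)
    moreover have "2 * Lmaxs / \<mu> * ln (\<delta> / \<epsilon>) \<ge> 0"
      using assms(3,6,14,15) by simp
    ultimately have "T \<ge> t\<delta>" by simp
    then obtain k where k: "T = t\<delta> + k" using le_Suc_ex by blast
    have "expectation (\<lambda>s. indicator X\<delta> s * d (w T s))
        = expectation (\<lambda>s. indicator (cball ws (sqrt \<delta>)) (w t\<delta> s) * d (w (t\<delta> + k) s))"
      by (intro Bochner_Integration.integral_cong) (auto simp: X_cball k)
    also have "\<dots> \<le> exp (- (\<mu> / (2 * Lmaxs))) ^ k
        * expectation (\<lambda>s. indicator (cball ws (sqrt \<delta>)) (w t\<delta> s) * d (w t\<delta> s))"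
      using assms(3,18) glocally_smooth_imp_lipschitz_near_minimizer[OF diff min smooth] \<open>\<delta> > 0\<close>
      by (intro decay) auto
    also have "expectation (\<lambda>s. indicator (cball ws (sqrt \<delta>)) (w t\<delta> s) * d (w t\<delta> s))
        \<le> expectation (\<lambda>s. \<delta> * indicator X\<delta> s)"
    proof (rule integral_mono)
      show "integrable M (\<lambda>s. indicator (cball ws (sqrt \<delta>)) (w t\<delta> s) * d (w t\<delta> s))"
        using integrable_iterates[of t\<delta> t\<delta> "\<lambda>x y. indicator (cball ws (sqrt \<delta>)) x * d y"] by simp
      show "integrable M (\<lambda>s. \<delta> * indicator X\<delta> s)" using X_integrable by simp
      show "indicator (cball ws (sqrt \<delta>)) (w t\<delta> s) * d (w t\<delta> s) \<le> \<delta> * indicator X\<delta> s"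
        if "s \<in> space M" for s
        unfolding X_cball[OF that, symmetric] by (auto simp: X_def indicator_def)
    qed
    also have "expectation (\<lambda>s. \<delta> * indicator X\<delta> s) = \<delta> * prob X\<delta>" using X by simp
    also have "exp (- (\<mu> / (2 * Lmaxs))) ^ k * (\<delta> * prob X\<delta>) \<le> 1 / (\<delta> / \<epsilon>) * (\<delta> * prob X\<delta>)"
      using after k assms(3,6,14,15) \<open>\<delta> > 0\<close>
      by (intro mult_right_mono exp_rate_power_le) auto
    also have "\<dots> = \<epsilon> * prob X\<delta>" using \<open>\<delta> > 0\<close> by simp
    finally have "expectation (\<lambda>s. indicator X\<delta> s * d (w T s)) \<le> \<epsilon> * prob X\<delta>" by simp
    then show ?thesis
      using \<open>prob X\<delta> > 0\<close>
      by (simp add: integral_uniform_measure[OF X \<open>prob X\<delta> > 0\<close> d_measurable] divide_le_eq)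
  qed
  with prob_X show ?thesis by (simp add: d_def)
qed

end
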